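(* Let $n\ge 2$ and let $a_1,\dots,a_n>0$ be real numbers. Let $M$ be the $n\times n$ diagonal partial matrix $\operatorname{diag}(a_1,\dots,a_n)$. Then $M$ is completable if and only if $\sum_{i=1}^n\sqrt{a_i}\le 1$, or equivalently $\|(a_1,\dots,a_n)\|_{1/2}\le 1$.
   Context: A partial matrix is a matrix in which only some entries are specified. The diagonal partial matrix $\operatorname{diag}(a_1,\dots,a_n)$ is the $n\times n$ partial matrix whose specified entries are exactly the diagonal ones, the $(i,i)$ entry being $a_i$; the off-diagonal entries are unspecified. $\Delta^{nn-1}$ denotes the standard simplex of real $n\times n$ matrices with nonnegative entries summing to one. A partial matrix is completable if its unspecified entries can be filled in so that the resulting matrix has rank one and lies in $\Delta^{nn-1}$. Notation: $\|(a_1,\dots,a_n)\|_{1/2}=\left(\sum_{i=1}^n |a_i|^{1/2}\right)^2$. *)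

theory Defs
  imports "HOL-Analysis.Analysis"
begin

text \<open>A partial matrix has entries \<open>Some x\<close> (specified, with value \<open>x\<close>) and
  \<open>None\<close> (unspecified).\<close>

type_synonym ('n, 'm) partial_matrix = "real option ^ 'n ^ 'm"

definition diag_partial :: "real ^ 'n \<Rightarrow> ('n::finite, 'n) partial_matrix" where
  "diag_partial a = (\<chi> i j. if i = j then Some (a $ i) else None)"

definition completes :: "real ^ 'n ^ 'm \<Rightarrow> ('n::finite, 'm::finite) partial_matrix \<Rightarrow> bool" where
  "completes A M \<longleftrightarrow> (\<forall>i j x. M $ i $ j = Some x \<longrightarrow> A $ i $ j = x)"

definition matrix_simplex :: "(real ^ 'n ^ 'm) set" where
  "matrix_simplex = {A. (\<forall>i j. A $ i $ j \<ge> 0) \<and> (\<Sum>i\<in>UNIV. \<Sum>j\<in>UNIV. A $ i $ j) = 1}"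

definition completable :: "('n::finite, 'm::finite) partial_matrix \<Rightarrow> bool" where
  "completable M \<longleftrightarrow> (\<exists>A. completes A M \<and> rank A = 1 \<and> A \<in> matrix_simplex)"

definition half_norm :: "real ^ 'n \<Rightarrow> real" where
  "half_norm a = (\<Sum>i\<in>UNIV. \<bar>a $ i\<bar> powr (1/2))\<^sup>2"

end

theory Submission
  imports Defs
begin

text \<open>
  A rank-one matrix is an outer product, \<open>A\<^sub>i\<^sub>j = u\<^sub>i v\<^sub>j\<close>, so each pair of mirrored entries has the
  product \<open>A\<^sub>i\<^sub>j A\<^sub>j\<^sub>i = A\<^sub>i\<^sub>i A\<^sub>j\<^sub>j\<close>, which the prescribed diagonal determines. For nonnegative entries
  the arithmetic-geometric mean inequality then gives
  \<open>sqrt (A\<^sub>i\<^sub>i) * sqrt (A\<^sub>j\<^sub>j) \<le> (A\<^sub>i\<^sub>j + A\<^sub>j\<^sub>i) / 2\<close>. Summed over all \<open>i\<close> and \<open>j\<close>, this says that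
  \<open>(\<Sum>\<^sub>i sqrt (A\<^sub>i\<^sub>i))\<^sup>2\<close> is at most the sum of all entries, which is \<open>1\<close> on the simplex. This is
  lemma \<open>sum_sqrt_diagonal_le\<close>.

  Conversely, the outer product of the vector \<open>(sqrt a\<^sub>i)\<^sub>i\<close> with itself has the right diagonal, but
  the sum of its entries, \<open>S\<^sup>2\<close> with \<open>S = \<Sum>\<^sub>i sqrt a\<^sub>i\<close>, may fall short of \<open>1\<close>. Multiplying a
  single coordinate \<open>k\<close> of the left factor by \<open>t > 0\<close> and dividing that of the right factor by \<open>t\<close>
  leaves the diagonal unchanged. With \<open>s = sqrt a\<^sub>k\<close> and \<open>r = S - s\<close>, the sum of the entries becomes
  \<open>(r + s t) (r + s / t)\<close>. It equals \<open>S\<^sup>2 \<le> 1\<close> at \<open>t = 1\<close> and grows without bound with \<open>t\<close>, since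
  \<open>r > 0\<close> when there are at least two coordinates; hence it takes the value \<open>1\<close>
  (lemma \<open>balancing_factor_exists\<close>).
\<close>

lemma rank_one_imp_outer_product:
  fixes A :: "real ^ 'n ^ 'm"
  assumes "rank A = 1"
  obtains u :: "real ^ 'm" and v :: "real ^ 'n" where "\<And>i j. A $ i $ j = u $ i * v $ j"
proof -
  obtain B where B: "rows A \<subseteq> span B" "card B = dim (rows A)"
    using basis_exists[of "rows A"] by metis
  with assms have "card B = 1"
    by (simp add: row_rank_def)
  then obtain v where "B = {v}"
    by (auto simp: card_1_singleton_iff)
  with B have "row i A \<in> span {v}" for i
    by (auto simp: rows_def)
  then have "\<forall>i. \<exists>c. row i A = c *\<^sub>R v"
    by (auto simp: span_singleton)
  then obtain c where c: "\<And>i. row i A = c i *\<^sub>R v"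
    by metis
  show thesis
  proof (rule that)
    show "A $ i $ j = (\<chi> i. c i) $ i * v $ j" for i j
      using arg_cong[OF c[of i], of "\<lambda>x. x $ j"] by (simp add: row_def)
  qed
qed

lemma rank_outer_product:
  fixes u :: "real ^ 'm" and v :: "real ^ 'n"
  assumes "u \<noteq> 0" and "v \<noteq> 0"
  shows "rank (\<chi> i j. u $ i * v $ j) = 1"
proof -
  let ?A = "(\<chi> i j. u $ i * v $ j) :: real ^ 'n ^ 'm"
  have row: "row i ?A = (u $ i) *\<^sub>R v" for i
    by (simp add: row_def vec_eq_iff)
  have "rows ?A \<subseteq> span {v}"
    by (auto simp: rows_def row span_singleton)
  then have "rank ?A \<le> 1"
    using dim_le_card[of "rows ?A" "{v}"] by (simp add: row_rank_def)
  moreover have "?A \<noteq> 0"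
    using assms by (auto simp: vec_eq_iff)
  then have "rank ?A \<noteq> 0"
    by (simp only: rank_eq_0 not_False_eq_True)
  ultimately show ?thesis
    by linarith
qed

text \<open>The prescribed diagonal bounds the total sum from below: the square on the left expands into
  the geometric means of the mirrored pairs of entries, and the sum of all entries is the sum of
  their arithmetic means.\<close>

lemma sum_sqrt_diagonal_le:
  fixes A :: "real ^ 'n ^ 'n"
  assumes "rank A = 1" and nonneg: "\<And>i j. A $ i $ j \<ge> 0"
  shows "(\<Sum>i\<in>UNIV. sqrt (A $ i $ i))\<^sup>2 \<le> (\<Sum>i\<in>UNIV. \<Sum>j\<in>UNIV. A $ i $ j)"
proof -
  obtain u v where A: "\<And>i j. A $ i $ j = u $ i * v $ j"
    using rank_one_imp_outer_product[OF \<open>rank A = 1\<close>] by metis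
  have mean: "sqrt (A $ i $ i) * sqrt (A $ j $ j) \<le> (A $ i $ j + A $ j $ i) / 2" for i j
  proof -
    have "A $ i $ i * A $ j $ j = A $ i $ j * A $ j $ i"
      by (simp add: A)
    then show ?thesis
      using arith_geo_mean_sqrt[OF nonneg nonneg, of i j j i] by (simp add: real_sqrt_mult[symmetric])
  qed
  have "(\<Sum>i\<in>UNIV. sqrt (A $ i $ i))\<^sup>2 = (\<Sum>i\<in>UNIV. \<Sum>j\<in>UNIV. sqrt (A $ i $ i) * sqrt (A $ j $ j))"
    by (simp add: power2_eq_square sum_product)
  also have "\<dots> \<le> (\<Sum>i\<in>UNIV. \<Sum>j\<in>UNIV. (A $ i $ j + A $ j $ i) / 2)"
    by (intro sum_mono mean)
  also have "\<dots> = ((\<Sum>i\<in>UNIV. \<Sum>j\<in>UNIV. A $ i $ j) + (\<Sum>i\<in>UNIV. \<Sum>j\<in>UNIV. A $ j $ i)) / 2"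
    by (simp add: sum.distrib sum_divide_distrib[symmetric])
  also have "(\<Sum>i\<in>UNIV. \<Sum>j\<in>UNIV. A $ j $ i) = (\<Sum>i\<in>UNIV. \<Sum>j\<in>UNIV. A $ i $ j)"
    by (rule sum.swap)
  finally show ?thesis
    by simp
qed

text \<open>The product equals \<open>r\<^sup>2 + s\<^sup>2 + r s (t + 1 / t)\<close>, so the equation fixes the value of
  \<open>t + 1 / t\<close>. A positive \<open>t\<close> exists as soon as this value is at least \<open>2\<close>, which amounts to
  \<open>(r + s)\<^sup>2 \<le> 1\<close>.\<close>

lemma balancing_factor_exists:
  fixes r s :: real
  assumes "r > 0" and "s > 0" and "r + s \<le> 1"
  obtains t where "t > 0" and "(r + s * t) * (r + s / t) = 1"
proof -
  define c where "c = (1 - r\<^sup>2 - s\<^sup>2) / (r * s)"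
  have "(r + s)\<^sup>2 \<le> 1"
    using assms by (simp add: power_le_one)
  then have c2: "c \<ge> 2"
    using assms by (simp add: c_def le_divide_eq power2_sum)
  have rsc: "r * s * c = 1 - r\<^sup>2 - s\<^sup>2"
    using assms by (simp add: c_def)
  \<comment> \<open>the larger root of \<open>t\<^sup>2 - c t + 1\<close>\<close>
  define t where "t = (c + sqrt (c\<^sup>2 - 4)) / 2"
  have disc: "c\<^sup>2 - 4 \<ge> 0"
    using power_mono[OF c2, of 2] by simp
  have t: "t > 0"
    using c2 disc by (simp add: t_def add_pos_nonneg)
  have "2 * t - c = sqrt (c\<^sup>2 - 4)"
    by (simp add: t_def field_simps)
  then have "(2 * t - c)\<^sup>2 = c\<^sup>2 - 4"
    using disc by simp
  then have "t * t + 1 = c * t"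
    by (simp add: power2_eq_square algebra_simps)
  then have tc: "t + 1 / t = c"
    using t by (simp add: field_simps)
  have "(r + s * t) * (r + s / t) = r\<^sup>2 + s\<^sup>2 + r * s * (t + 1 / t)"
    using t by (simp add: field_simps power2_eq_square)
  also have "\<dots> = 1"
    by (simp add: tc rsc)
  finally show thesis
    using t that by blast
qed

lemma rank_one_with_diagonal_exists:
  fixes a :: "real ^ 'n"
  assumes "CARD('n) \<ge> 2" and pos: "\<And>i. a $ i > 0" and le: "(\<Sum>i\<in>UNIV. sqrt (a $ i)) \<le> 1"
  shows "\<exists>A :: real ^ 'n ^ 'n. (\<forall>i. A $ i $ i = a $ i) \<and> rank A = 1 \<and> A \<in> matrix_simplex"
proof -
  fix k :: 'n
  define s where "s = sqrt (a $ k)"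
  define r where "r = (\<Sum>i\<in>UNIV - {k}. sqrt (a $ i))"
  have split_k: "(\<Sum>i\<in>UNIV. f i) = (\<Sum>i\<in>UNIV - {k}. f i) + f k" for f :: "'n \<Rightarrow> real"
    by (simp add: sum.remove[of UNIV k])
  have "UNIV - {k} \<noteq> {}"
  proof
    assume "UNIV - {k} = {}"
    then have "CARD('n) \<le> card {k}"
      by (intro card_mono) auto
    with \<open>CARD('n) \<ge> 2\<close> show False
      by simp
  qed
  then have "r > 0"
    unfolding r_def using pos by (intro sum_pos) auto
  moreover have "s > 0"
    using pos by (simp add: s_def)
  moreover have "r + s \<le> 1"
    using le by (simp add: split_k r_def s_def)
  ultimately obtain t where t: "t > 0" "(r + s * t) * (r + s / t) = 1"
    by (rule balancing_factor_exists)
  define u :: "real ^ 'n" where "u = (\<chi> i. if i = k then s * t else sqrt (a $ i))"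
  define v :: "real ^ 'n" where "v = (\<chi> i. if i = k then s / t else sqrt (a $ i))"
  define A :: "real ^ 'n ^ 'n" where "A = (\<chi> i j. u $ i * v $ j)"
  have uv_pos: "u $ i > 0" "v $ i > 0" for i
    using t \<open>s > 0\<close> pos by (auto simp: u_def v_def)
  then have "u \<noteq> 0" "v \<noteq> 0"
    by (metis less_irrefl zero_index)+
  then have "rank A = 1"
    unfolding A_def by (rule rank_outer_product)
  moreover have "A $ i $ i = a $ i" for i
  proof -
    have "sqrt (a $ j) * sqrt (a $ j) = a $ j" for j
      using pos[of j] by simp
    then show ?thesis
      using t by (simp add: A_def u_def v_def s_def)
  qed
  moreover have "A \<in> matrix_simplex"
  proof -
    have "(\<Sum>i\<in>UNIV. u $ i) = r + s * t" "(\<Sum>i\<in>UNIV. v $ i) = r + s / t"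
      by (simp_all add: split_k u_def v_def r_def)
    then have "(\<Sum>i\<in>UNIV. \<Sum>j\<in>UNIV. A $ i $ j) = 1"
      using t by (simp add: A_def sum_product[symmetric])
    moreover have "A $ i $ j \<ge> 0" for i j
      using uv_pos[of i] uv_pos[of j] by (simp add: A_def)
    ultimately show ?thesis
      by (simp add: matrix_simplex_def)
  qed
  ultimately show ?thesis
    by blast
qed

lemma completes_diag_partial_iff: "completes A (diag_partial a) \<longleftrightarrow> (\<forall>i. A $ i $ i = a $ i)"
  by (auto simp: completes_def diag_partial_def)

theorem theorem2p2:
  fixes a :: "real ^ 'n::finite"
  assumes "CARD('n) \<ge> 2"
    and "\<And>i. a $ i > 0"
  shows "(completable (diag_partial a) \<longleftrightarrow> (\<Sum>i\<in>UNIV. sqrt (a $ i)) \<le> 1)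
    \<and> ((\<Sum>i\<in>UNIV. sqrt (a $ i)) \<le> 1 \<longleftrightarrow> half_norm a \<le> 1)"
proof
  have nonneg: "(\<Sum>i\<in>UNIV. sqrt (a $ i)) \<ge> 0"
    using assms(2) by (intro sum_nonneg) (simp add: less_imp_le)
  have "half_norm a = (\<Sum>i\<in>UNIV. sqrt (a $ i))\<^sup>2"
    using assms(2) by (simp add: half_norm_def powr_half_sqrt abs_of_pos less_imp_le)
  then show "(\<Sum>i\<in>UNIV. sqrt (a $ i)) \<le> 1 \<longleftrightarrow> half_norm a \<le> 1"
    using nonneg by (simp add: abs_square_le_1)
  show "completable (diag_partial a) \<longleftrightarrow> (\<Sum>i\<in>UNIV. sqrt (a $ i)) \<le> 1"
  proof
    assume "completable (diag_partial a)"
    then obtain A where "\<And>i. A $ i $ i = a $ i" "rank A = 1" "A \<in> matrix_simplex"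
      by (auto simp: completable_def completes_diag_partial_iff)
    then have "(\<Sum>i\<in>UNIV. sqrt (a $ i))\<^sup>2 \<le> 1"
      using sum_sqrt_diagonal_le[of A] by (simp add: matrix_simplex_def)
    then show "(\<Sum>i\<in>UNIV. sqrt (a $ i)) \<le> 1"
      using nonneg by (simp add: abs_square_le_1)
  next
    assume "(\<Sum>i\<in>UNIV. sqrt (a $ i)) \<le> 1"
    then show "completable (diag_partial a)"
      using rank_one_with_diagonal_exists[OF assms] by (simp add: completable_def completes_diag_partial_iff)
  qed
qed

end
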